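(* Let $k$ be a field of characteristic $0$. (1) Let $(A^\bullet,m,d,c)$ be a curved dg-algebra over $k$. If $c^n=0$ for some integer $n\ge 1$, then $d^{4n-2}=0$, i.e. $(A^\bullet,d)$ is a $(4n-2)$-complex. (2) This bound is sharp for $n=2$: there exists a curved dg-algebra $(A^\bullet,m,d,c)$ over $k$ with $c^2=0$ (so that $d^6=0$ by (1)) and $d^5\neq 0$.
   Context: A curved dg-algebra $(A^\bullet,m,d,c)$ over a field $k$ of characteristic $0$ consists of an associative unital $\mathbb{Z}$-graded $k$-algebra $A^\bullet=\bigoplus_{i\in\mathbb{Z}}A^i$ with product $m$ and with every $A^i$ a finite-dimensional $k$-vector space; a $k$-linear map $d:A^\bullet\to A^\bullet$ of degree $1$ satisfying the graded Leibniz rule $d(xy)=d(x)y+(-1)^{|x|}x\,d(y)$ for homogeneous $x$; and an element $c\in A^2$ (the curvature) with $d(c)=0$ and $d^2=\operatorname{ad}_c$. Here $\operatorname{ad}_x=[x,-]$ for homogeneous $x$, where $[x,y]=xy-(-1)^{|x||y|}yx$ is the graded commutator. An $N$-complex is a graded module $(C^\bullet,d)$ with $d$ of degree $1$ and $d^N=0$. *)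

theory Defs
  imports Complex_Main "HOL-Library.Function_Algebras"
begin

text \<open>
  Algebras live on subsets of an ambient vector space, so that the existence of an algebra can be
  stated as an existential over a fixed type. Only the values of the operations on
  \<open>total\<close>, the internal direct sum of the homogeneous pieces, are constrained.
\<close>

locale graded_space = vector_space scale
  for scale :: "'k::field \<Rightarrow> 'v::ab_group_add \<Rightarrow> 'v" +
  fixes gr :: "int \<Rightarrow> 'v set"
  assumes subspace_gr: "subspace (gr i)"
    and direct: "\<lbrakk>finite I; \<And>i. i \<in> I \<Longrightarrow> x i \<in> gr i; (\<Sum>i\<in>I. x i) = 0; j \<in> I\<rbrakk> \<Longrightarrow> x j = 0"
begin

definition total :: "'v set" where
  "total = span (\<Union>i. gr i)"

end

locale graded_endo = graded_space scale gr
  for scale :: "'k::field \<Rightarrow> 'v::ab_group_add \<Rightarrow> 'v" and gr :: "int \<Rightarrow> 'v set" +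
  fixes d :: "'v \<Rightarrow> 'v"
  assumes d_add: "\<lbrakk>x \<in> total; y \<in> total\<rbrakk> \<Longrightarrow> d (x + y) = d x + d y"
    and d_scale: "x \<in> total \<Longrightarrow> d (scale a x) = scale a (d x)"
    and d_degree: "x \<in> gr i \<Longrightarrow> d x \<in> gr (i + 1)"

locale N_complex = graded_endo scale gr d
  for scale :: "'k::field \<Rightarrow> 'v::ab_group_add \<Rightarrow> 'v" and gr :: "int \<Rightarrow> 'v set"
    and d :: "'v \<Rightarrow> 'v" +
  fixes N :: nat
  assumes d_power_zero: "x \<in> total \<Longrightarrow> (d ^^ N) x = 0"

locale graded_algebra = graded_space scale gr
  for scale :: "'k::field \<Rightarrow> 'v::ab_group_add \<Rightarrow> 'v" and gr :: "int \<Rightarrow> 'v set" +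
  fixes mult :: "'v \<Rightarrow> 'v \<Rightarrow> 'v" (infixl "\<odot>" 70)
    and one :: 'v
  assumes finite_dim: "\<exists>B. finite B \<and> gr i = span B"
    and mult_degree: "\<lbrakk>x \<in> gr i; y \<in> gr j\<rbrakk> \<Longrightarrow> x \<odot> y \<in> gr (i + j)"
    and one_degree: "one \<in> gr 0"
    and mult_assoc: "\<lbrakk>x \<in> total; y \<in> total; z \<in> total\<rbrakk> \<Longrightarrow> (x \<odot> y) \<odot> z = x \<odot> (y \<odot> z)"
    and one_left: "x \<in> total \<Longrightarrow> one \<odot> x = x"
    and one_right: "x \<in> total \<Longrightarrow> x \<odot> one = x"
    and distrib_left: "\<lbrakk>x \<in> total; y \<in> total; z \<in> total\<rbrakk> \<Longrightarrow> x \<odot> (y + z) = x \<odot> y + x \<odot> z"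
    and distrib_right: "\<lbrakk>x \<in> total; y \<in> total; z \<in> total\<rbrakk> \<Longrightarrow> (x + y) \<odot> z = x \<odot> z + y \<odot> z"
    and scale_left: "\<lbrakk>x \<in> total; y \<in> total\<rbrakk> \<Longrightarrow> scale a x \<odot> y = scale a (x \<odot> y)"
    and scale_right: "\<lbrakk>x \<in> total; y \<in> total\<rbrakk> \<Longrightarrow> x \<odot> scale a y = scale a (x \<odot> y)"
begin

text \<open>
  The degrees \<open>p\<close> of \<open>x\<close> and \<open>q\<close> of \<open>y\<close> are explicit arguments,
  since the element \<open>0\<close> has no well-defined degree.
\<close>

definition graded_commutator :: "int \<Rightarrow> int \<Rightarrow> 'v \<Rightarrow> 'v \<Rightarrow> 'v" where
  "graded_commutator p q x y = x \<odot> y - scale ((-1) powi (p * q)) (y \<odot> x)"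

end

text \<open>
  The identity \<open>d\<^sup>2 = ad\<^sub>c\<close> is imposed on homogeneous elements,
  where the graded commutator is defined; both sides extend linearly to \<open>total\<close>.
\<close>

locale curved_dg_algebra = graded_algebra scale gr mult one + graded_endo scale gr d
  for scale :: "'k::field \<Rightarrow> 'v::ab_group_add \<Rightarrow> 'v" and gr :: "int \<Rightarrow> 'v set"
    and mult :: "'v \<Rightarrow> 'v \<Rightarrow> 'v" (infixl "\<odot>" 70) and one :: 'v and d :: "'v \<Rightarrow> 'v" +
  fixes c :: 'v
  assumes leibniz: "\<lbrakk>x \<in> gr i; y \<in> total\<rbrakk> \<Longrightarrow> d (x \<odot> y) = d x \<odot> y + scale ((-1) powi i) (x \<odot> d y)"
    and c_degree: "c \<in> gr 2"
    and d_c: "d c = 0"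
    and d_squared: "x \<in> gr i \<Longrightarrow> d (d x) = graded_commutator 2 i c x"

end

theory Submission
  imports Defs
begin

text \<open>
  Left and right multiplication by \<open>c\<close> commute and \<open>d\<^sup>2\<close> is their difference,
  so \<open>d\<^sup>2\<^sup>m x\<close> is a combination of the elements \<open>c\<^sup>i x c\<^sup>j\<close> with \<open>i + j = m\<close>;
  if \<open>m = 2n - 1\<close>, one of \<open>i, j\<close> is at least \<open>n\<close>.
  For sharpness take the \<open>4 \<times> 4\<close> matrices, graded by row index minus column index,
  with \<open>d = [D, -]\<close> and \<open>c = D\<^sup>2\<close> for the nilpotent Jordan block \<open>D\<close>. Then
  \<open>c\<^sup>2 = D\<^sup>4 = 0\<close>, while \<open>d\<^sup>5\<close> maps the matrix unit \<open>E\<^sub>0\<^sub>2\<close> to \<open>-2 E\<^sub>3\<^sub>0\<close>.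
\<close>

section \<open>Reduction from the total space to homogeneous elements\<close>

context graded_space
begin

lemma gr_subset_total: "x \<in> gr i \<Longrightarrow> x \<in> total"
  unfolding total_def by (rule span_base) blast

lemma subspace_total: "subspace total"
  unfolding total_def by (rule subspace_span)

lemma total_closed:
  shows zero_total: "0 \<in> total"
    and add_total: "x \<in> total \<Longrightarrow> y \<in> total \<Longrightarrow> x + y \<in> total"
    and diff_total: "x \<in> total \<Longrightarrow> y \<in> total \<Longrightarrow> x - y \<in> total"
    and scale_total: "x \<in> total \<Longrightarrow> scale a x \<in> total"
  using subspace_total subspace_0 subspace_add subspace_diff subspace_scale by auto

lemma total_induct [consumes 1, case_names zero add scale gr]:
  assumes "x \<in> total" and "P 0"
    and "\<And>x y. \<lbrakk>x \<in> total; y \<in> total; P x; P y\<rbrakk> \<Longrightarrow> P (x + y)"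
    and "\<And>a x. \<lbrakk>x \<in> total; P x\<rbrakk> \<Longrightarrow> P (scale a x)"
    and "\<And>i x. x \<in> gr i \<Longrightarrow> P x"
  shows "P x"
proof -
  \<comment> \<open>Membership is carried along because the hypotheses for sums and multiples
    presuppose it.\<close>
  have "x \<in> total \<and> P x"
    using \<open>x \<in> total\<close>[unfolded total_def]
  proof (induction rule: span_induct)
    case base
    then show ?case
      using assms by (auto simp: subspace_def total_closed)
  next
    case (step x)
    then show ?case
      using assms(5) gr_subset_total by blast
  qed
  then show ?thesis ..
qed

end

context graded_endo
begin

lemma d_zero: "d 0 = 0"
  using d_add[OF zero_total zero_total] by simp

lemma d_diff:
  assumes "x \<in> total" "y \<in> total"
  shows "d (x - y) = d x - d y"
  using d_add[OF diff_total[OF assms] assms(2)] by (simp add: algebra_simps)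

lemma d_uminus: "x \<in> total \<Longrightarrow> d (- x) = - d x"
  using d_diff[of 0 x] by (simp add: d_zero zero_total)

lemma d_total: "x \<in> total \<Longrightarrow> d x \<in> total"
  by (induction rule: total_induct)
    (auto simp: d_zero d_add d_scale total_closed intro: gr_subset_total d_degree)

lemma d_funpow_total: "x \<in> total \<Longrightarrow> (d ^^ m) x \<in> total"
  by (induction m) (auto simp: d_total)

lemma d_funpow_diff:
  "\<lbrakk>x \<in> total; y \<in> total\<rbrakk> \<Longrightarrow> (d ^^ m) (x - y) = (d ^^ m) x - (d ^^ m) y"
  by (induction m) (auto simp: d_diff d_funpow_total)

end

section \<open>Arithmetic and inner derivations in graded algebras\<close>

context graded_algebra
begin

lemma mult_zero_right: "x \<in> total \<Longrightarrow> x \<odot> 0 = 0"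
  using distrib_left[of x 0 0] zero_total by simp

lemma mult_zero_left: "x \<in> total \<Longrightarrow> 0 \<odot> x = 0"
  using distrib_right[of 0 0 x] zero_total by simp

lemma mult_diff_right:
  assumes "x \<in> total" "y \<in> total" "z \<in> total"
  shows "x \<odot> (y - z) = x \<odot> y - x \<odot> z"
  using distrib_left[OF assms(1) diff_total[OF assms(2,3)] assms(3)] by (simp add: algebra_simps)

lemma mult_diff_left:
  assumes "x \<in> total" "y \<in> total" "z \<in> total"
  shows "(x - y) \<odot> z = x \<odot> z - y \<odot> z"
  using distrib_right[OF diff_total[OF assms(1,2)] assms(2,3)] by (simp add: algebra_simps)

lemma mult_total:
  assumes "x \<in> total" "y \<in> total"
  shows "x \<odot> y \<in> total"
  using assms
proof (induction arbitrary: y rule: total_induct)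
  case (gr i x)
  note x = gr_subset_total[OF gr(1)]
  \<comment> \<open>The degree axiom speaks of homogeneous factors only, so a second induction
    splits the right factor once the left one is homogeneous.\<close>
  from gr(2) show ?case
    by (induction rule: total_induct)
      (auto simp: mult_zero_right distrib_left scale_right x total_closed
        intro: gr_subset_total mult_degree[OF gr(1)])
qed (auto simp: mult_zero_left distrib_right scale_left total_closed)

lemma one_total: "one \<in> total"
  by (rule gr_subset_total[OF one_degree])

lemma power_total: "x \<in> total \<Longrightarrow> power.power one (\<odot>) x n \<in> total"
  by (induction n) (auto simp: power.power.simps one_total mult_total)

text \<open>Powers unfold with the new factor on the left; this lets a factor arriving on the right
  be absorbed as well.\<close>

lemma power_commute:
  "x \<in> total \<Longrightarrow> power.power one (\<odot>) x n \<odot> x = x \<odot> power.power one (\<odot>) x n"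
  by (induction n) (auto simp: power.power.simps one_left one_right mult_assoc power_total)

lemma power_zero_mono:
  assumes "x \<in> total" and "power.power one (\<odot>) x m = 0" and "m \<le> n"
  shows "power.power one (\<odot>) x n = 0"
  using assms(3) by (induction rule: dec_induct)
    (auto simp: power.power.simps assms(1,2) mult_zero_right)

text \<open>The graded commutator with an element of degree 1 is a derivation, and its square is the
  commutator with \<open>D \<odot> D\<close>: the two terms \<open>D \<odot> x \<odot> D\<close>
  cancel. Linearity of \<open>d\<close> is a separate hypothesis since the commutator formula only
  covers homogeneous arguments.\<close>

lemma inner_curved_dg_algebra:
  assumes "graded_endo scale gr d" and D: "D \<in> gr 1"
    and d: "\<And>i x. x \<in> gr i \<Longrightarrow> d x = graded_commutator 1 i D x"
  shows "curved_dg_algebra scale gr (\<odot>) one d (D \<odot> D)"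
proof -
  interpret graded_endo scale gr d by fact
  note D_total = gr_subset_total[OF D]
  \<comment> \<open>\<open>d x\<close> has degree one higher than \<open>x\<close>; this sign change
    makes the mixed terms of \<open>d (d x)\<close> cancel.\<close>
  have powi_minus: "(-1 :: 'k) powi (1 + i) = - ((-1) powi i)" for i
    by (simp add: power_int_add)
  have powi_square: "((-1) powi i :: 'k) * (-1) powi i = 1" for i
    by (simp flip: power_int_mult_distrib)
  have d_eq: "d x = D \<odot> x - scale ((-1) powi i) (x \<odot> D)" if "x \<in> gr i" for x i
    using d[OF that] by (simp add: graded_commutator_def)
  show ?thesis
  proof
    show "D \<odot> D \<in> gr 2"
      using mult_degree[OF D D] by simp
    show "d (D \<odot> D) = 0"
      using d_eq[OF mult_degree[OF D D]] by (simp add: mult_assoc D_total)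
    show "d (x \<odot> y) = d x \<odot> y + scale ((-1) powi i) (x \<odot> d y)"
      if x: "x \<in> gr i" and y: "y \<in> total" for x y i
      using y
    proof (induction rule: total_induct)
      case zero
      show ?case
        using x by (simp add: d_zero d_total mult_zero_right gr_subset_total)
    next
      case (add y z)
      then show ?case
        using gr_subset_total[OF x]
        by (simp add: d_add d_total distrib_left mult_total scale_right_distrib)
    next
      case (scale a y)
      then show ?case
        using gr_subset_total[OF x]
        by (simp add: d_scale d_total scale_right mult_total scale_right_distrib mult.commute)
    next
      case (gr j y)
      note T = gr_subset_total[OF x] gr_subset_total[OF gr] D_total
      show ?case
        using T by (simp add: d_eq[OF x] d_eq[OF gr] d_eq[OF mult_degree[OF x gr]]
            mult_diff_left mult_diff_right mult_total mult_assoc scale_left scale_right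
            scale_total scale_right_diff_distrib power_int_add)
    qed
    show "d (d x) = graded_commutator 2 i (D \<odot> D) x" if x: "x \<in> gr i" for x i
    proof -
      note T = gr_subset_total[OF x] D_total
      have dx: "d x \<in> gr (1 + i)"
        using d_degree[OF x] by (simp add: add.commute)
      show ?thesis
        using T unfolding d_eq[OF dx] powi_minus
        by (simp add: d_eq[OF x] graded_commutator_def power_int_mult
            mult_diff_left mult_diff_right mult_total mult_assoc scale_left scale_right
            scale_total scale_right_diff_distrib powi_square)
    qed
  qed
qed

end

section \<open>Nilpotent curvature and the bound on the order of the differential\<close>

context curved_dg_algebra
begin

lemma c_total: "c \<in> total"
  by (rule gr_subset_total[OF c_degree])

text \<open>As \<open>c\<close> has even degree, the sign in its graded commutator is always 1, so
  the formula extends to inhomogeneous elements.\<close>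

lemma d_squared_total: "x \<in> total \<Longrightarrow> d (d x) = c \<odot> x - x \<odot> c"
proof (induction rule: total_induct)
  case (gr i x)
  then show ?case
    by (simp add: d_squared graded_commutator_def power_int_mult)
qed (auto simp: d_zero d_add d_scale d_total c_total mult_zero_left mult_zero_right
    distrib_left distrib_right scale_left scale_right scale_right_diff_distrib)

text \<open>Each \<open>d\<^sup>2\<close> lowers \<open>m\<close> by one and yields a difference of
  two terms in which \<open>i\<close> or \<open>j\<close> has grown by one, so
  \<open>i + j + m\<close> is invariant. At \<open>m = 0\<close> one of the exponents has reached
  \<open>n\<close>.\<close>

lemma d_funpow_power_mult_eq_0:
  assumes "power.power one (\<odot>) c n = 0" and "x \<in> total" and "2 * n - 1 \<le> i + j + m"
  shows "(d ^^ (2 * m)) (power.power one (\<odot>) c i \<odot> (x \<odot> power.power one (\<odot>) c j)) = 0"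
  using assms(3)
proof (induction m arbitrary: i j)
  case 0
  then have "n \<le> i \<or> n \<le> j"
    by linarith
  then show ?case
    using power_zero_mono[OF c_total assms(1)] assms(2)
    by (auto simp: mult_zero_left mult_zero_right mult_total power_total c_total)
next
  case (Suc m)
  let ?p = "power.power one (\<odot>) c"
  let ?z = "\<lambda>i j. ?p i \<odot> (x \<odot> ?p j)"
  have z: "?z i j \<in> total" for i j
    by (simp add: mult_total power_total c_total assms(2))
  have "d (d (?z i j)) = ?z (Suc i) j - ?z i (Suc j)"
    using d_squared_total[OF z, of i j]
    by (simp add: power.power.simps mult_assoc mult_total power_total c_total assms(2) power_commute)
  then have "(d ^^ (2 * Suc m)) (?z i j) = (d ^^ (2 * m)) (?z (Suc i) j - ?z i (Suc j))"
    by (simp add: funpow_swap1)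
  also have "\<dots> = 0"
    using Suc.prems Suc.IH[of "Suc i" j] Suc.IH[of i "Suc j"] by (simp add: d_funpow_diff z)
  finally show ?case .
qed

lemma N_complex_if_power_eq_0:
  assumes "power.power one (\<odot>) c n = 0"
  shows "N_complex scale gr d (4 * n - 2)"
proof
  fix x assume "x \<in> total"
  moreover have "2 * (2 * n - 1) = 4 * n - 2"
    by simp
  ultimately show "(d ^^ (4 * n - 2)) x = 0"
    \<comment> \<open>With both exponents 0 the sandwiched element is \<open>x\<close>
      itself.\<close>
    using d_funpow_power_mult_eq_0[OF assms, of x 0 0 "2 * n - 1"]
    by (simp add: power.power.simps one_left one_right)
qed

end

section \<open>The graded algebra of 4 by 4 matrices\<close>

text \<open>The \<open>4 \<times> 4\<close> matrix \<open>x\<close> is encoded by the sequence with \<open>x\<^sub>i\<^sub>j\<close> at position \<open>4i + j\<close>.\<close>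

definition mat_degree :: "nat \<Rightarrow> int" where
  "mat_degree n = int (n div 4) - int (n mod 4)"

definition mat_scale :: "'k::field \<Rightarrow> (nat \<Rightarrow> 'k) \<Rightarrow> nat \<Rightarrow> 'k" where
  "mat_scale a x = (\<lambda>n. a * x n)"

text \<open>The bound 16 cuts the matrices out of the infinite-dimensional sequence space.\<close>

definition mat_gr :: "int \<Rightarrow> (nat \<Rightarrow> 'k::field) set" where
  "mat_gr p = {x. \<forall>n. x n \<noteq> 0 \<longrightarrow> n < 16 \<and> mat_degree n = p}"

definition mat_mult :: "(nat \<Rightarrow> 'k::field) \<Rightarrow> (nat \<Rightarrow> 'k) \<Rightarrow> nat \<Rightarrow> 'k" where
  "mat_mult x y =
    (\<lambda>n. if n < 16 then \<Sum>l<4. x (4 * (n div 4) + l) * y (4 * l + n mod 4) else 0)"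

definition mat_one :: "nat \<Rightarrow> 'k::field" where
  "mat_one = (\<lambda>n. if n < 16 \<and> n div 4 = n mod 4 then 1 else 0)"

definition mat_unit :: "nat \<Rightarrow> nat \<Rightarrow> 'k::field" where
  "mat_unit m = (\<lambda>n. if n = m then 1 else 0)"

text \<open>Positions 4, 9, 14 are \<open>E10\<close>, \<open>E21\<close>, \<open>E32\<close>, the
  subdiagonal.\<close>

definition jordan :: "nat \<Rightarrow> 'k::field" where
  "jordan = mat_unit 4 + mat_unit 9 + mat_unit 14"

text \<open>The parity automorphism, acting as \<open>(-1) powi p\<close> in degree
  \<open>p\<close>. It absorbs the sign of the graded commutator, so that \<open>mat_d\<close> is
  one linear formula with no reference to a degree.\<close>

definition mat_sign :: "(nat \<Rightarrow> 'k::field) \<Rightarrow> nat \<Rightarrow> 'k" where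
  "mat_sign x = (\<lambda>n. (-1) powi mat_degree n * x n)"

definition mat_d :: "(nat \<Rightarrow> 'k::field) \<Rightarrow> nat \<Rightarrow> 'k" where
  "mat_d x = mat_mult jordan x - mat_mult (mat_sign x) jordan"

lemma sum_fun_apply: "(\<Sum>i\<in>I. f i) n = (\<Sum>i\<in>I. f i n)"
  by (induction I rule: infinite_finite_induct) auto

lemma lt_16_cases:
  assumes "n < (16::nat)"
  obtains i j where "i < 4" "j < 4" "n = 4 * i + j"
  using that[of "n div 4" "n mod 4"] assms by auto

lemma mat_mult_apply:
  "i < 4 \<Longrightarrow> j < 4 \<Longrightarrow> mat_mult x y (4 * i + j) = (\<Sum>l<4. x (4 * i + l) * y (4 * l + j))"
  by (simp add: mat_mult_def)

lemma mat_degree_apply: "j < 4 \<Longrightarrow> mat_degree (4 * i + j) = int i - int j"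
  by (simp add: mat_degree_def)

interpretation mat: vector_space "mat_scale :: 'k::field \<Rightarrow> _"
  by unfold_locales (auto simp: mat_scale_def fun_eq_iff algebra_simps)

lemma graded_space_mat: "graded_space (mat_scale :: 'k::field \<Rightarrow> _) mat_gr"
proof
  show "mat.subspace (mat_gr i :: (nat \<Rightarrow> 'k) set)" for i
    unfolding mat.subspace_def by (auto simp: mat_gr_def mat_scale_def) (metis add_0)+
  fix I :: "int set" and x :: "int \<Rightarrow> nat \<Rightarrow> 'k" and j
  assume I: "finite I" "\<And>i. i \<in> I \<Longrightarrow> x i \<in> mat_gr i" "(\<Sum>i\<in>I. x i) = 0" "j \<in> I"
  show "x j = 0"
  proof
    fix n
    show "x j n = 0 n"
    \<comment> \<open>At a position of degree \<open>j\<close> only the summand \<open>x j\<close>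
      can be nonzero, so the vanishing sum isolates its entry; at any other position
      \<open>x j\<close> vanishes by homogeneity.\<close>
    proof (cases "mat_degree n = j")
      case True
      have "0 = (\<Sum>i\<in>I. x i n)"
        using I(3) by (simp flip: sum_fun_apply)
      also have "\<dots> = (\<Sum>i\<in>I. if i = j then x j n else 0)"
        using I(2) True by (intro sum.cong) (auto simp: mat_gr_def)
      finally show ?thesis
        using I(1,4) by simp
    next
      case False
      then show ?thesis
        using I(2)[OF I(4)] by (auto simp: mat_gr_def)
    qed
  qed
qed

interpretation mat: graded_space "mat_scale :: 'k::field \<Rightarrow> _" mat_gr
  by (rule graded_space_mat)

lemma mat_total_support: "x \<in> mat.total \<Longrightarrow> 16 \<le> n \<Longrightarrow> x n = 0"
  by (induction rule: mat.total_induct) (auto simp: mat_scale_def mat_gr_def not_less[symmetric])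

lemma mat_eqI:
  fixes x y :: "nat \<Rightarrow> 'k::field"
  assumes "\<And>n. 16 \<le> n \<Longrightarrow> x n = y n"
    and "\<And>i j. i < 4 \<Longrightarrow> j < 4 \<Longrightarrow> x (4 * i + j) = y (4 * i + j)"
  shows "x = y"
proof
  fix n :: nat
  show "x n = y n"
    using assms by (cases "n < 16") (auto elim: lt_16_cases)
qed

lemma mat_gr_I:
  fixes x :: "nat \<Rightarrow> 'k::field"
  assumes "\<And>n. 16 \<le> n \<Longrightarrow> x n = 0"
    and "\<And>i j. i < 4 \<Longrightarrow> j < 4 \<Longrightarrow> x (4 * i + j) \<noteq> 0 \<Longrightarrow> int i - int j = p"
  shows "x \<in> mat_gr p"
  unfolding mat_gr_def
proof clarify
  fix n
  assume n: "x n \<noteq> 0"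
  then have "n < 16"
    using assms(1) by (meson not_less)
  moreover from this n have "mat_degree n = p"
    using assms(2) by (auto elim!: lt_16_cases simp: mat_degree_apply)
  ultimately show "n < 16 \<and> mat_degree n = p" ..
qed

lemma mat_gr_D: "x \<in> mat_gr p \<Longrightarrow> j < 4 \<Longrightarrow> x (4 * i + j) \<noteq> 0 \<Longrightarrow> int i - int j = p"
  by (auto simp: mat_gr_def mat_degree_apply)

lemma mat_unit_degree: "n < 16 \<Longrightarrow> mat_unit n \<in> mat_gr (mat_degree n)"
  by (auto simp: mat_gr_def mat_unit_def)

text \<open>Provides the finite spanning sets demanded by \<open>finite_dim\<close>: the matrix
  units of the given degree.\<close>

lemma mat_gr_eq_span:
  "(mat_gr p :: (nat \<Rightarrow> 'k::field) set) = mat.span (mat_unit ` {n. n < 16 \<and> mat_degree n = p})"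
    (is "?G = mat.span (?u ` ?S)")
proof
  show "?G \<subseteq> mat.span (?u ` ?S)"
  proof
    fix x :: "nat \<Rightarrow> 'k"
    assume x: "x \<in> ?G"
    have "x = (\<Sum>m\<in>?S. mat_scale (x m) (mat_unit m))"
    proof
      fix n
      have "(\<Sum>m\<in>?S. mat_scale (x m) (mat_unit m)) n = (\<Sum>m\<in>?S. if m = n then x n else 0)"
        unfolding sum_fun_apply by (intro sum.cong) (auto simp: mat_scale_def mat_unit_def)
      also have "\<dots> = x n"
        using x by (auto simp: mat_gr_def)
      finally show "x n = (\<Sum>m\<in>?S. mat_scale (x m) (mat_unit m)) n" ..
    qed
    also have "\<dots> \<in> mat.span (?u ` ?S)"
      by (intro mat.span_sum mat.span_scale mat.span_base imageI)
    finally show "x \<in> mat.span (?u ` ?S)" .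
  qed
  show "mat.span (?u ` ?S) \<subseteq> ?G"
    using mat_unit_degree by (intro mat.span_minimal mat.subspace_gr) blast
qed

lemma mat_mult_assoc: "mat_mult (mat_mult x y) z = mat_mult x (mat_mult y z)"
proof (rule mat_eqI)
  fix i j :: nat
  assume ij: "i < 4" "j < 4"
  have "mat_mult (mat_mult x y) z (4 * i + j) =
      (\<Sum>l<4. \<Sum>m<4. x (4 * i + m) * y (4 * m + l) * z (4 * l + j))"
    using ij by (simp add: mat_mult_apply sum_distrib_right)
  also have "\<dots> = (\<Sum>m<4. \<Sum>l<4. x (4 * i + m) * y (4 * m + l) * z (4 * l + j))"
    by (rule sum.swap)
  also have "\<dots> = mat_mult x (mat_mult y z) (4 * i + j)"
    using ij by (simp add: mat_mult_apply sum_distrib_left mult.assoc)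
  finally show "mat_mult (mat_mult x y) z (4 * i + j) = mat_mult x (mat_mult y z) (4 * i + j)" .
qed (simp add: mat_mult_def)

lemma mat_mult_add_right: "mat_mult x (y + z) = mat_mult x y + mat_mult x z"
  and mat_mult_add_left: "mat_mult (x + y) z = mat_mult x z + mat_mult y z"
  and mat_mult_scale_left: "mat_mult (mat_scale a x) y = mat_scale a (mat_mult x y)"
  and mat_mult_scale_right: "mat_mult x (mat_scale a y) = mat_scale a (mat_mult x y)"
  by (auto simp: mat_mult_def mat_scale_def fun_eq_iff algebra_simps sum.distrib sum_distrib_left)

text \<open>In a nonzero term of the product the degrees \<open>i - l\<close> and
  \<open>l - j\<close> of the two entries add up to \<open>i - j\<close>.\<close>

lemma mat_mult_degree:
  assumes "x \<in> mat_gr p" "y \<in> mat_gr q"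
  shows "mat_mult x y \<in> mat_gr (p + q)"
proof (rule mat_gr_I)
  fix i j :: nat
  assume ij: "i < 4" "j < 4" and "mat_mult x y (4 * i + j) \<noteq> 0"
  then obtain l where l: "l < 4" "x (4 * i + l) * y (4 * l + j) \<noteq> 0"
    unfolding mat_mult_apply[OF ij] by (metis (lifting) lessThan_iff sum.neutral)
  then show "int i - int j = p + q"
    using mat_gr_D[OF assms(1) l(1), of i] mat_gr_D[OF assms(2) ij(2), of l] by auto
qed (simp add: mat_mult_def)

lemma mat_one_apply: "i < 4 \<Longrightarrow> j < 4 \<Longrightarrow> mat_one (4 * i + j) = (if i = j then 1 else 0)"
  by (auto simp: mat_one_def)

lemma graded_algebra_mat:
  "graded_algebra (mat_scale :: 'k::field \<Rightarrow> _) mat_gr mat_mult mat_one"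
proof
  show "\<exists>B. finite B \<and> (mat_gr i :: (nat \<Rightarrow> 'k) set) = mat.span B" for i
    by (intro exI[of _ "mat_unit ` {n. n < 16 \<and> mat_degree n = i}"] conjI mat_gr_eq_span) simp
  show "mat_one \<in> (mat_gr 0 :: (nat \<Rightarrow> 'k) set)"
    by (auto simp: mat_one_def mat_gr_def mat_degree_def)
  fix x :: "nat \<Rightarrow> 'k"
  assume x: "x \<in> mat.total"
  have support: "x n = 0" if "16 \<le> n" for n
    using mat_total_support[OF x that] .
  show "mat_mult mat_one x = x"
  proof (rule mat_eqI)
    fix i j :: nat
    assume ij: "i < 4" "j < 4"
    have "mat_mult mat_one x (4 * i + j) = (\<Sum>l<4. if l = i then x (4 * i + j) else 0)"
      unfolding mat_mult_apply[OF ij] using ij by (intro sum.cong) (auto simp: mat_one_apply)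
    then show "mat_mult mat_one x (4 * i + j) = x (4 * i + j)"
      using ij by simp
  qed (simp add: mat_mult_def support)
  show "mat_mult x mat_one = x"
  proof (rule mat_eqI)
    fix i j :: nat
    assume ij: "i < 4" "j < 4"
    have "mat_mult x mat_one (4 * i + j) = (\<Sum>l<4. if l = j then x (4 * i + j) else 0)"
      unfolding mat_mult_apply[OF ij] using ij by (intro sum.cong) (auto simp: mat_one_apply)
    then show "mat_mult x mat_one (4 * i + j) = x (4 * i + j)"
      using ij by simp
  qed (simp add: mat_mult_def support)
qed (simp_all add: mat_mult_degree mat_mult_assoc mat_mult_add_left mat_mult_add_right
    mat_mult_scale_left mat_mult_scale_right)

interpretation mat: graded_algebra "mat_scale :: 'k::field \<Rightarrow> _" mat_gr mat_mult mat_one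
  by (rule graded_algebra_mat)

section \<open>The inner differential of the Jordan block\<close>

lemma jordan_degree: "jordan \<in> mat_gr 1"
  by (auto simp: jordan_def mat_unit_def mat_gr_def mat_degree_def)

lemma mat_sign_gr: "x \<in> mat_gr p \<Longrightarrow> mat_sign x = mat_scale ((-1) powi p) x"
  by (auto simp: mat_sign_def mat_scale_def mat_gr_def fun_eq_iff)

text \<open>On a homogeneous element the parity automorphism is a scalar; this is the form
  \<open>inner_curved_dg_algebra\<close> requires.\<close>

lemma mat_d_gr: "x \<in> mat_gr p \<Longrightarrow> mat_d x = mat.graded_commutator 1 p jordan x"
  by (simp add: mat_d_def mat_sign_gr mat.graded_commutator_def mat_mult_scale_left)

lemma graded_endo_mat_d: "graded_endo (mat_scale :: 'k::field \<Rightarrow> _) mat_gr mat_d"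
proof
  fix x y :: "nat \<Rightarrow> 'k" and a
  have "mat_sign (x + y) = mat_sign x + mat_sign y"
    "mat_sign (mat_scale a x) = mat_scale a (mat_sign x)"
    by (auto simp: mat_sign_def mat_scale_def fun_eq_iff algebra_simps)
  then show "mat_d (x + y) = mat_d x + mat_d y" "mat_d (mat_scale a x) = mat_scale a (mat_d x)"
    by (simp_all add: mat_d_def mat_mult_add_left mat_mult_add_right mat_mult_scale_left
        mat_mult_scale_right mat.scale_right_diff_distrib)
next
  fix x :: "nat \<Rightarrow> 'k" and i
  assume x: "x \<in> mat_gr i"
  show "mat_d x \<in> mat_gr (i + 1)"
    unfolding mat_d_gr[OF x] mat.graded_commutator_def
    using mat_mult_degree[OF jordan_degree x] mat_mult_degree[OF x jordan_degree]
    by (auto intro!: mat.subspace_diff mat.subspace_scale mat.subspace_gr simp: add.commute)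
qed

text \<open>The rule for multiplying matrix units in the position encoding; it turns the
  computations with \<open>jordan\<close> below into simplification.\<close>

lemma mat_mult_unit:
  assumes "m < 16" "n < 16"
  shows "mat_mult (mat_unit m) (mat_unit n) =
    (if m mod 4 = n div 4 then mat_unit (4 * (m div 4) + n mod 4) else 0)"
proof -
  from assms obtain a b e f
    where m: "b < 4" "m = 4 * a + b" and n: "e < 4" "f < 4" "n = 4 * e + f"
    by (auto elim!: lt_16_cases)
  \<comment> \<open>Uniqueness of row and column as quotient and remainder modulo 4.\<close>
  have index_eq: "4 * i + j = 4 * k + l \<longleftrightarrow> i = k \<and> j = l" if "j < 4" "l < 4" for i j k l :: nat
    using that by presburger
  show ?thesis
  proof (rule mat_eqI)
    fix i j :: nat
    assume ij: "i < 4" "j < 4"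
    have "mat_mult (mat_unit m) (mat_unit n) (4 * i + j) =
        (\<Sum>l<4. if l = b then if i = a \<and> b = e \<and> j = f then 1 else 0 else 0)"
      unfolding mat_mult_apply[OF ij]
      using m n ij by (intro sum.cong) (auto simp: mat_unit_def index_eq)
    then show "mat_mult (mat_unit m) (mat_unit n) (4 * i + j) =
        (if m mod 4 = n div 4 then mat_unit (4 * (m div 4) + n mod 4) else 0) (4 * i + j)"
      using m n ij by (auto simp: mat_unit_def index_eq)
  next
    fix k :: nat
    assume "16 \<le> k"
    moreover have "4 * (m div 4) + n mod 4 < 16"
      using assms by presburger
    ultimately show "mat_mult (mat_unit m) (mat_unit n) k =
        (if m mod 4 = n div 4 then mat_unit (4 * (m div 4) + n mod 4) else 0) k"
      using assms by (auto simp: mat_mult_def mat_unit_def)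
  qed
qed

text \<open>Left multiplication by the block shifts rows down by one, and there are only four rows.
  This is the vanishing of the squared curvature.\<close>

lemma jordan_power_4: "mat_mult (mat_mult jordan jordan) (mat_mult jordan jordan) = 0"
  by (simp add: jordan_def mat_mult_add_left mat_mult_add_right mat_mult_unit)

lemma mat_d_unit:
  assumes "n < 16"
  shows "mat_d (mat_unit n) = mat_mult jordan (mat_unit n)
    - mat_scale ((-1) powi mat_degree n) (mat_mult (mat_unit n) jordan)"
  using mat_d_gr[OF mat_unit_degree[OF assms]] by (simp add: mat.graded_commutator_def)

text \<open>With \<open>c\<^sup>2 = 0\<close> the fourth power of the differential is
  \<open>x \<mapsto> -2 c x c\<close>, which sends \<open>E02\<close> to \<open>-2 E20\<close>; one
  more step gives \<open>-2 E30\<close>. The degree rises from -2 to the top degree 3.\<close>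

lemma mat_d_power_5: "(mat_d ^^ 5) (mat_unit 2) = mat_scale (-2 :: 'k::field) (mat_unit 12)"
proof -
  interpret graded_endo "mat_scale :: 'k::field \<Rightarrow> _" mat_gr mat_d
    by (rule graded_endo_mat_d)
  have units: "mat_unit n \<in> mat.total" if "n < 16" for n
    using mat.gr_subset_total[OF mat_unit_degree[OF that]] .
  note simps = mat_d_unit jordan_def mat_degree_def mat_mult_add_left mat_mult_add_right mat_mult_unit
    d_add d_diff d_uminus d_scale mat.total_closed units
  have "mat_d (mat_unit 2) = (mat_unit 6 - mat_unit 1 :: nat \<Rightarrow> 'k)"
    by (simp add: simps)
  moreover have "mat_d (mat_unit 6 - mat_unit 1) = (mat_unit 10 - mat_unit 0 :: nat \<Rightarrow> 'k)"
    by (simp add: simps)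
  moreover have "mat_d (mat_unit 10 - mat_unit 0) = (mat_unit 14 - mat_unit 9 - mat_unit 4 :: nat \<Rightarrow> 'k)"
    by (simp add: simps)
  \<comment> \<open>In odd degree the commutator is an anticommutator: the contributions at
    \<open>E31\<close> cancel, those at \<open>E20\<close> add up.\<close>
  moreover have "mat_d (mat_unit 14 - mat_unit 9 - mat_unit 4) = mat_scale (-2 :: 'k) (mat_unit 8)"
    by (simp add: simps) (auto simp: mat_scale_def mat_unit_def fun_eq_iff)
  moreover have "mat_d (mat_scale (-2 :: 'k) (mat_unit 8)) = mat_scale (-2) (mat_unit 12)"
    by (simp add: simps)
  ultimately show ?thesis
    by (simp add: numeral_eq_Suc)
qed

theorem theorem8:
  shows "(\<forall>(scale :: 'k::field_char_0 \<Rightarrow> 'v::ab_group_add \<Rightarrow> 'v) gr mult one d c (n::nat).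
            curved_dg_algebra scale gr mult one d c \<longrightarrow> n \<ge> 1 \<longrightarrow>
            power.power one mult c n = 0 \<longrightarrow>
            N_complex scale gr d (4 * n - 2))
       \<and> (\<exists>(scale :: 'k \<Rightarrow> (nat \<Rightarrow> 'k) \<Rightarrow> (nat \<Rightarrow> 'k)) gr mult one d c.
            curved_dg_algebra scale gr mult one d c \<and>
            power.power one mult c 2 = 0 \<and>
            (\<exists>x \<in> graded_space.total scale gr. (d ^^ 5) x \<noteq> 0))"
proof (intro conjI allI impI)
  fix scale :: "'k \<Rightarrow> 'v \<Rightarrow> 'v" and gr mult one d c and n :: nat
  assume "curved_dg_algebra scale gr mult one d c" and "power.power one mult c n = 0"
  then show "N_complex scale gr d (4 * n - 2)"
    by (rule curved_dg_algebra.N_complex_if_power_eq_0)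
next
  let ?c = "mat_mult jordan jordan :: nat \<Rightarrow> 'k"
  have c: "?c \<in> mat.total"
    by (intro mat.mult_total mat.gr_subset_total[OF jordan_degree])
  have "curved_dg_algebra (mat_scale :: 'k \<Rightarrow> _) mat_gr mat_mult mat_one mat_d ?c"
    by (intro mat.inner_curved_dg_algebra graded_endo_mat_d jordan_degree mat_d_gr)
  moreover have "power.power mat_one mat_mult ?c 2 = 0"
    by (simp add: numeral_2_eq_2 power.power.simps mat.one_right c jordan_power_4)
  moreover have "mat_unit 2 \<in> mat.total"
    by (rule mat.gr_subset_total[OF mat_unit_degree]) simp
  moreover have "(mat_d ^^ 5) (mat_unit 2) \<noteq> (0 :: nat \<Rightarrow> 'k)"
  proof
    assume "(mat_d ^^ 5) (mat_unit 2) = (0 :: nat \<Rightarrow> 'k)"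
    \<comment> \<open>The entry there is -2, nonzero in characteristic 0.\<close>
    from fun_cong[OF this, of 12] show False
      unfolding mat_d_power_5 by (simp add: mat_scale_def mat_unit_def)
  qed
  ultimately show "\<exists>(scale :: 'k \<Rightarrow> (nat \<Rightarrow> 'k) \<Rightarrow> (nat \<Rightarrow> 'k)) gr mult one d c.
      curved_dg_algebra scale gr mult one d c \<and>
      power.power one mult c 2 = 0 \<and>
      (\<exists>x \<in> graded_space.total scale gr. (d ^^ 5) x \<noteq> 0)"
    by blast
qed

end
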